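(* For every $n\ge1$, the Eulerian polynomial $A_n(x)$ satisfies $$A_n(x)=\sum_{T\in\mathrm{SYT}(n)}G_T\;x^{\,n+1-\ell(\lambda(T))}.$$
   Context: **Eulerian polynomials.** For a permutation $\pi$ of $\{1,\ldots,n\}$, a descent is an index $i\in\{1,\ldots,n\}$ with $\pi(i)>\pi(i+1)$ or $i=n$; $\mathrm{des}(\pi)$ is the number of descents (so the last index always counts). $A_n(x)=\sum_{\pi\in\mathfrak S_n}x^{\mathrm{des}(\pi)}$. **Standard Young tableaux.** $\mathrm{SYT}(n)$ is the set of standard Young tableaux of size $n$, drawn with rows numbered from bottom to top: for a partition $\lambda=(\lambda_1\ge\lambda_2\ge\cdots)$ of $n$, row $r$ has $\lambda_r$ left-justified boxes, the boxes are filled with $1,\ldots,n$ each used once, rows increase from left to right and columns increase from bottom to top. $\lambda(T)$ is the shape of $T$ and $\ell(\lambda(T))$ is its number of nonzero parts (number of rows). **$g$-index.** To the left of $T\in\mathrm{SYT}(n)$ one adds a special column (column 0) of $n$ boxes in rows $1,\ldots,n$, the box in row $r$ containing the label $r$. If $v\in\{1,\ldots,n\}$ is in column $i\ge1$ and row $j\ge 1$ of $T$, $g_T(v)$ is the number of boxes in column $i-1$ and in rows $j'\ge j$ whose entry is less than or equal to $v$ (for $i=1$ the boxes counted are those of column 0). The $g$-index of $T$ is $G_T=g_T(1)g_T(2)\cdots g_T(n)$. *)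

theory Defs
  imports "HOL-Combinatorics.Permutations" "HOL-Computational_Algebra.Polynomial"
begin

text \<open>The last index always counts as a descent.\<close>

definition des :: "nat \<Rightarrow> (nat \<Rightarrow> nat) \<Rightarrow> nat" where
  "des n p = card {i \<in> {1..n}. i = n \<or> p i > p (i + 1)}"

definition Eulerian_poly :: "nat \<Rightarrow> int poly" where
  "Eulerian_poly n = (\<Sum>p | p permutes {1..n}. monom 1 (des n p))"

definition is_partition :: "nat list \<Rightarrow> nat \<Rightarrow> bool" where
  "is_partition l n \<longleftrightarrow> sorted_wrt (\<ge>) l \<and> 0 \<notin> set l \<and> sum_list l = n"

text \<open>
  A tableau is the list of its rows from bottom to top, each row read from left to right.
  A box is a pair (column, row), both counted from 1. Column 0 is the special column to
  the left of the tableau, whose box in row \<open>r\<close> has label \<open>r\<close>.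
\<close>

definition shape :: "nat list list \<Rightarrow> nat list" where
  "shape T = map length T"

definition boxes :: "nat list list \<Rightarrow> (nat \<times> nat) set" where
  "boxes T = {(c, r). 1 \<le> r \<and> r \<le> length (shape T) \<and> 1 \<le> c \<and> c \<le> shape T ! (r - 1)}"

definition ext_boxes :: "nat \<Rightarrow> nat list list \<Rightarrow> (nat \<times> nat) set" where
  "ext_boxes n T = {0} \<times> {1..n} \<union> boxes T"

definition entry :: "nat list list \<Rightarrow> nat \<times> nat \<Rightarrow> nat" where
  "entry T = (\<lambda>(c, r). if c = 0 then r else T ! (r - 1) ! (c - 1))"

definition SYT :: "nat \<Rightarrow> nat list list set" where
  "SYT n = {T. is_partition (shape T) n \<and>
     bij_betw (entry T) (boxes T) {1..n} \<and>
     (\<forall>c r. (c, r) \<in> boxes T \<longrightarrow> (c + 1, r) \<in> boxes T \<longrightarrow> entry T (c, r) < entry T (c + 1, r)) \<and>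
     (\<forall>c r. (c, r) \<in> boxes T \<longrightarrow> (c, r + 1) \<in> boxes T \<longrightarrow> entry T (c, r) < entry T (c, r + 1))}"

definition box_of :: "nat list list \<Rightarrow> nat \<Rightarrow> nat \<times> nat" where
  "box_of T v = (THE b. b \<in> boxes T \<and> entry T b = v)"

definition g_val :: "nat \<Rightarrow> nat list list \<Rightarrow> nat \<Rightarrow> nat" where
  "g_val n T v = (case box_of T v of (i, j) \<Rightarrow>
     card {j'. j' \<ge> j \<and> (i - 1, j') \<in> ext_boxes n T \<and> entry T (i - 1, j') \<le> v})"

definition g_index :: "nat \<Rightarrow> nat list list \<Rightarrow> nat" where
  "g_index n T = (\<Prod>v = 1..n. g_val n T v)"

lemma finite_SYT: "finite (SYT n)"
proof (rule finite_subset)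
  show "SYT n \<subseteq> {T. set T \<subseteq> {xs. set xs \<subseteq> {1..n} \<and> length xs \<le> n} \<and> length T \<le> n}"
  proof (clarify, intro conjI subsetI CollectI)
    fix T assume T: "T \<in> SYT n"
    then have s: "sum_list (map length T) = n" and nz: "0 \<notin> set (map length T)"
      and e: "entry T ` boxes T = {1..n}"
      by (auto simp: SYT_def is_partition_def shape_def bij_betw_def)
    have "length T \<le> sum_list (map length T)"
      using nz
    proof (induction T)
      case (Cons a T)
      then have "length a > 0" "length T \<le> sum_list (map length T)" by auto
      then show ?case unfolding list.map list.size sum_list.Cons by linarith
    qed simp
    with s show "length T \<le> n" by simp
    fix xs assume xs: "xs \<in> set T"
    show "length xs \<le> n"
      using member_le_sum_list[of "length xs" "map length T"] xs s by auto
    fix x assume "x \<in> set xs"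
    with xs obtain r c where rc: "r < length T" "c < length (T ! r)" "x = T ! r ! c"
      by (metis in_set_conv_nth)
    then have "(c + 1, r + 1) \<in> boxes T" "entry T (c + 1, r + 1) = x"
      by (auto simp: boxes_def shape_def entry_def)
    with e show "x \<in> {1..n}" by blast
  qed
qed (intro finite_lists_length_le finite_atLeastAtMost)

lemma box_of_eq:
  assumes "T \<in> SYT n" "b \<in> boxes T"
  shows "box_of T (entry T b) = b"
  using assms unfolding box_of_def SYT_def bij_betw_def inj_on_def by blast

end

theory Submission
  imports Defs
begin

text \<open>
  Both sides satisfy the recurrence that sends \<open>x^d\<close>, in size \<open>n\<close>, to
  \<open>d x^d + (n + 1 - d) x^(d + 1)\<close>. For permutations this counts the gaps into which the value
  \<open>n + 1\<close> can be inserted: the \<open>d\<close> gaps that follow a descent preserve \<open>des\<close>, and the others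
  raise it by one. For tableaux, one adds the box \<open>n + 1\<close> to a tableau with \<open>l = n + 1 - d\<close> rows.
  On top of the first column it has \<open>g\<close>-value \<open>n + 1 - l = d\<close>. At the end of row \<open>r \<le> l\<close> its
  \<open>g\<close>-value is the number of rows of the same length as row \<open>r\<close>, and these numbers sum up to \<open>l\<close>
  over all rows that can be extended.
\<close>

section \<open>The recurrence as a linear operator on polynomials\<close>

text \<open>This is (n + 1) x P + (x - x^2) P'. The differential form makes linearity in
  \<open>P\<close> evident, so both generating functions can be treated term by term.\<close>

definition eulerian_step :: "nat \<Rightarrow> int poly \<Rightarrow> int poly" where
  "eulerian_step n P = [:0, int n + 1:] * P + [:0, 1, -1:] * pderiv P"

text \<open>The factors x and -x^2 turn the derivative d x^(d-1) into d x^d and -d x^(d+1); the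
  latter merges with (n + 1) x^(d+1). The coefficients are integers, so nothing is
  truncated.\<close>

lemma eulerian_step_monom:
  "eulerian_step n (monom a d) =
     monom (a * int d) d + monom (a * (int n + 1 - int d)) (Suc d)"
proof -
  have X: "[:0, b:] = monom b 1" for b :: int
    by (simp add: monom_altdef)
  have Y: "[:0, 1, -1:] = monom (1::int) 1 - monom 1 2"
    by (simp add: monom_altdef numeral_2_eq_2)
  show ?thesis
  \<comment> \<open>The case \<open>d = 0\<close> is separate because the exponent
    \<open>d - 1\<close> of the derivative is truncated there.\<close>
  proof (cases d)
    case 0
    then show ?thesis
      by (simp add: eulerian_step_def X pderiv_monom mult_monom del: mult_pCons_left mult_pCons_right)
  next
    case (Suc e)
    then show ?thesis
      unfolding eulerian_step_def X Y pderiv_monom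
      by (simp add: mult_monom left_diff_distrib add_monom diff_monom algebra_simps
        flip: add_monom diff_monom)
  qed
qed

lemma eulerian_step_sum: "eulerian_step n (\<Sum>a\<in>A. f a) = (\<Sum>a\<in>A. eulerian_step n (f a))"
proof -
  have "eulerian_step n (P + Q) = eulerian_step n P + eulerian_step n Q" for P Q
    by (simp only: eulerian_step_def pderiv_add distrib_left distrib_right ac_simps)
  moreover have "eulerian_step n 0 = 0" by (simp add: eulerian_step_def)
  ultimately show ?thesis
    by (induction A rule: infinite_finite_induct) auto
qed

section \<open>Insertion of the largest value into a permutation\<close>

definition des_set :: "nat \<Rightarrow> (nat \<Rightarrow> nat) \<Rightarrow> nat set" where
  "des_set n p = {i \<in> {1..n}. i = n \<or> p i > p (i + 1)}"

text \<open>In one-line notation, gap \<open>i\<close> lies after position \<open>i\<close>, and gap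
  0 is the front. Arguments beyond \<open>Suc n\<close> stay fixed, as \<open>permutes\<close>
  demands; so does 0, through the first branch.\<close>

definition insert_max :: "nat \<Rightarrow> (nat \<Rightarrow> nat) \<Rightarrow> nat \<Rightarrow> (nat \<Rightarrow> nat)" where
  "insert_max n p i = (\<lambda>j. if j \<le> i then p j else if j = Suc i then Suc n
     else if j \<le> Suc n then p (j - 1) else j)"

lemma permutes_atLeastAtMost_le:
  fixes p :: "nat \<Rightarrow> nat"
  assumes p: "p permutes {1..n}" and "j \<le> n"
  shows "p j \<le> n"
  using assms(2) permutes_not_in[OF p, of 0] permutes_in_image[OF p, of j]
  by (cases "j = 0") auto

lemma insert_max_permutes:
  assumes p: "p permutes {1..n}" and i: "i \<le> n"
  shows "insert_max n p i permutes {1..Suc n}"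
proof (rule bij_imp_permutes)
  have in_range: "p j \<in> {1..n}" if "1 \<le> j" "j \<le> n" for j
    using p that permutes_in_image[of p "{1..n}" j] by auto
  have "inj_on (insert_max n p i) {1..Suc n}"
  proof (rule inj_onI)
    fix j k
    assume j: "j \<in> {1..Suc n}" and k: "k \<in> {1..Suc n}"
      and eq: "insert_max n p i j = insert_max n p i k"
    have inj: "p a = p b \<longleftrightarrow> a = b" for a b
      using permutes_inj[OF p] by (auto dest: injD)
    \<comment> \<open>The value \<open>Suc n\<close> is new, so its position cannot collide with one
      carrying a value of \<open>p\<close>.\<close>
    have lt: "p a \<noteq> Suc n" if "a \<le> n" for a
      using permutes_atLeastAtMost_le[OF p that] by simp
    have "j - 1 \<le> n" "k - 1 \<le> n" using j k by auto
    then show "j = k"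
      using j k i eq lt[of j] lt[of k] lt[of "j - 1"] lt[of "k - 1"]
      by (auto simp: insert_max_def inj split: if_splits)
  qed
  moreover have "insert_max n p i ` {1..Suc n} \<subseteq> {1..Suc n}"
  proof clarify
    fix j assume j: "j \<in> {1..Suc n}"
    then have "p (j - 1) \<le> n" by (intro permutes_atLeastAtMost_le[OF p]) auto
    with j show "insert_max n p i j \<in> {1..Suc n}"
      using in_range[of j] in_range[of "j - 1"] i by (auto simp: insert_max_def)
  qed
  ultimately show "bij_betw (insert_max n p i) {1..Suc n} {1..Suc n}"
    by (simp add: bij_betw_def endo_inj_surj)
next
  fix j assume "j \<notin> {1..Suc n}"
  then show "insert_max n p i j = j"
    using p i permutes_not_in[of p "{1..n}" j] by (auto simp: insert_max_def)
qed

text \<open>The position of the value \<open>Suc n\<close> reveals the gap, and deleting that value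
  gives back the permutation.\<close>

lemma insert_max_eq_iff:
  assumes p: "p permutes {1..n}" and q: "q permutes {1..n}" and "i \<le> n" "k \<le> n"
    and eq: "insert_max n p i = insert_max n q k"
  shows "p = q \<and> i = k"
proof
  have "insert_max n p i (Suc i) = Suc n" "insert_max n q k (Suc k) = Suc n"
    by (auto simp: insert_max_def)
  moreover have "inj (insert_max n q k)"
    using insert_max_permutes[OF q \<open>k \<le> n\<close>] permutes_inj by blast
  ultimately have "Suc i = Suc k"
    using eq by (metis injD)
  then show ik: "i = k" by simp
  show "p = q"
  proof
    fix j
    show "p j = q j"
    proof (cases "j \<le> n")
      case True
      then show ?thesis
        using fun_cong[OF eq, of j] fun_cong[OF eq, of "Suc j"] ik
        by (cases "j \<le> i") (auto simp: insert_max_def)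
    next
      case False
      then show ?thesis
        using p q permutes_not_in[of p "{1..n}" j] permutes_not_in[of q "{1..n}" j] by simp
    qed
  qed
qed

lemma bij_betw_insert_max:
  "bij_betw (\<lambda>(p, i). insert_max n p i) ({p. p permutes {1..n}} \<times> {..n})
     {p. p permutes {1..Suc n}}"
proof -
  let ?A = "{p. p permutes {1..n}} \<times> {..n}"
  let ?f = "\<lambda>(p, i). insert_max n p i"
  have inj: "inj_on ?f ?A"
    by (rule inj_onI) (auto simp del: One_nat_def dest: insert_max_eq_iff)
  \<comment> \<open>Surjectivity follows by counting: n! permutations times n + 1 gaps make (n +
    1)!.\<close>
  have "?f ` ?A = {p. p permutes {1..Suc n}}"
  proof (rule card_subset_eq)
    show "finite {p. p permutes {1..Suc n}}"
      by (rule finite_permutations) simp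
    show "?f ` ?A \<subseteq> {p. p permutes {1..Suc n}}"
      using insert_max_permutes by auto
    show "card (?f ` ?A) = card {p. p permutes {1..Suc n}}"
      unfolding card_image[OF inj] by (simp add: card_cartesian_product card_permutations)
  qed
  with inj show ?thesis by (simp add: bij_betw_def)
qed

text \<open>The new maximum is itself a descent, being last or followed by a smaller value, and it
  makes position \<open>i\<close> an ascent. Descents before \<open>i\<close> stay in place; those
  after \<open>i\<close> shift by one.\<close>

lemma des_set_insert_max:
  assumes p: "p permutes {1..n}" and i: "i \<le> n"
  shows "des_set (Suc n) (insert_max n p i) =
    insert (Suc i) ({j \<in> des_set n p. j < i} \<union> Suc ` {j \<in> des_set n p. j > i})"
proof (rule set_eqI)
  fix k
  note le = permutes_atLeastAtMost_le[OF p]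
  consider "k < i" | "k = i" | "k = Suc i" | j where "k = Suc j" "i < j"
    by (metis Suc_lessE less_Suc_eq linorder_neqE_nat)
  then show "k \<in> des_set (Suc n) (insert_max n p i) \<longleftrightarrow>
    k \<in> insert (Suc i) ({j \<in> des_set n p. j < i} \<union> Suc ` {j \<in> des_set n p. j > i})"
  proof cases
    case 1 then show ?thesis using i by (auto simp: des_set_def insert_max_def)
  next
    case 2 then show ?thesis using i le[of i] by (auto simp: des_set_def insert_max_def)
  next
    case 3 then show ?thesis using i le[of "Suc i"]
      by (auto simp: des_set_def insert_max_def less_Suc_eq_le)
  next
    case 4 then show ?thesis using i by (auto simp: des_set_def insert_max_def)
  qed
qed

text \<open>One descent is gained at \<open>Suc i\<close>, and only a descent at \<open>i\<close>
  can be lost. Gap 0 always raises the count, since 0 is never in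
  \<open>des_set n p\<close>.\<close>

lemma des_insert_max:
  assumes p: "p permutes {1..n}" and i: "i \<le> n"
  shows "des (Suc n) (insert_max n p i) = (if i \<in> des_set n p then des n p else Suc (des n p))"
proof -
  let ?D = "des_set n p"
  have fin: "finite ?D" by (simp add: des_set_def)
  have "des (Suc n) (insert_max n p i) = card (des_set (Suc n) (insert_max n p i))"
    by (simp add: des_def des_set_def)
  also have "\<dots> = Suc (card {j \<in> ?D. j < i} + card (Suc ` {j \<in> ?D. j > i}))"
    unfolding des_set_insert_max[OF assms] using fin
    by (subst card_insert_disjoint, simp, force, subst card_Un_disjoint) auto
  also have "\<dots> = Suc (card {j \<in> ?D. j < i} + card {j \<in> ?D. j > i})"
    by (simp add: card_image)
  also have "card {j \<in> ?D. j < i} + card {j \<in> ?D. j > i} = card (?D - {i})"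
    using fin by (subst card_Un_disjoint[symmetric]) (auto intro!: arg_cong[where f = card])
  also have "Suc (card (?D - {i})) = (if i \<in> ?D then card ?D else Suc (card ?D))"
    using card_Suc_Diff1[OF fin] by simp
  finally show ?thesis by (simp add: des_def des_set_def)
qed

lemma Eulerian_poly_Suc: "Eulerian_poly (Suc n) = eulerian_step n (Eulerian_poly n)"
proof -
  have "Eulerian_poly (Suc n) =
      (\<Sum>(p, i)\<in>{p. p permutes {1..n}} \<times> {..n}. monom 1 (des (Suc n) (insert_max n p i)))"
    unfolding Eulerian_poly_def sum.reindex_bij_betw[OF bij_betw_insert_max, symmetric]
    by (simp add: case_prod_unfold)
  also have "\<dots> = (\<Sum>p | p permutes {1..n}. \<Sum>i\<le>n. monom 1 (des (Suc n) (insert_max n p i)))"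
    by (simp add: sum.cartesian_product)
  also have "\<dots> = (\<Sum>p | p permutes {1..n}. eulerian_step n (monom 1 (des n p)))"
  proof (rule sum.cong[OF refl])
    fix p assume "p \<in> {p. p permutes {1..n}}"
    then have p: "p permutes {1..n}" by simp
    let ?D = "des_set n p" and ?d = "des n p"
    have D: "?D \<subseteq> {..n}" "card ?D = ?d"
      by (auto simp: des_set_def des_def)
    \<comment> \<open>This bound lets the size of the complement of \<open>?D\<close> be written as
      an integer difference.\<close>
    then have d: "?d \<le> Suc n"
      using card_mono[OF finite_atMost D(1)] by simp
    have "(\<Sum>i\<le>n. monom (1::int) (des (Suc n) (insert_max n p i))) =
        (\<Sum>i\<le>n. if i \<in> ?D then monom 1 ?d else monom 1 (Suc ?d))"
      by (rule sum.cong) (auto simp: des_insert_max[OF p])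
    also have "\<dots> = (\<Sum>i\<in>{..n} \<inter> ?D. monom 1 ?d) + (\<Sum>i\<in>{..n} - ?D. monom 1 (Suc ?d))"
      by (simp add: sum.If_cases Diff_eq)
    also have "\<dots> = monom (int ?d) ?d + monom (int n + 1 - int ?d) (Suc ?d)"
      using D d by (simp add: Int_absorb1 card_Diff_subset finite_subset[OF D(1)] of_nat_diff
          of_nat_monom mult_monom)
    finally show "(\<Sum>i\<le>n. monom (1::int) (des (Suc n) (insert_max n p i))) =
        eulerian_step n (monom 1 ?d)"
      by (simp add: eulerian_step_monom)
  qed
  finally show ?thesis
    by (simp add: Eulerian_poly_def eulerian_step_sum)
qed

section \<open>Addition of the largest box to a tableau\<close>

text \<open>Rows are counted from 0 here, and rows above the tableau have length 0.\<close>

definition row_len :: "nat list list \<Rightarrow> nat \<Rightarrow> nat" where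
  "row_len T i = (if i < length T then length (T ! i) else 0)"

definition add_box :: "nat \<Rightarrow> nat list list \<Rightarrow> nat \<Rightarrow> nat list list" where
  "add_box a T r = (if r < length T then T[r := T ! r @ [a]] else T @ [[a]])"

text \<open>The rows that can take a further box, with \<open>length T\<close> standing for a new
  row on top. Comparing with every lower row, not only the next one, spares a special case for row
  0.\<close>

definition addable :: "nat list list \<Rightarrow> nat set" where
  "addable T = {r. r \<le> length T \<and> (\<forall>i<r. row_len T i > row_len T r)}"

lemma finite_addable: "finite (addable T)"
  by (rule finite_subset[of _ "{..length T}"]) (auto simp: addable_def)

text \<open>Length 0 above the tableau already excludes boxes there, so no upper bound on
  \<open>r\<close> appears; \<open>r - 1\<close> passes from rows counted from 1 to rows counted
  from 0.\<close>

lemma boxes_row_len: "(c, r) \<in> boxes T \<longleftrightarrow> 1 \<le> c \<and> 1 \<le> r \<and> c \<le> row_len T (r - 1)"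
  by (auto simp: boxes_def shape_def row_len_def)

lemma row_len_add_box:
  "r \<le> length T \<Longrightarrow> row_len (add_box a T r) = (row_len T)(r := Suc (row_len T r))"
  by (auto simp: row_len_def add_box_def fun_eq_iff nth_append)

lemma boxes_add_box:
  assumes "r \<le> length T"
  shows "boxes (add_box a T r) = insert (Suc (row_len T r), Suc r) (boxes T)"
  using assms by (auto simp: boxes_row_len row_len_add_box split: if_splits)

lemma new_box_notin: "(Suc (row_len T r), Suc r) \<notin> boxes T"
  by (simp add: boxes_row_len)

lemma entry_add_box_new:
  "r \<le> length T \<Longrightarrow> entry (add_box a T r) (Suc (row_len T r), Suc r) = a"
  by (auto simp: entry_def add_box_def row_len_def nth_append)

lemma entry_add_box_old:
  "r \<le> length T \<Longrightarrow> b \<in> boxes T \<Longrightarrow> entry (add_box a T r) b = entry T b"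
  by (cases b) (auto simp: entry_def add_box_def boxes_row_len row_len_def nth_append
      nth_list_update split: if_splits)

lemma is_partition_row_len:
  "is_partition (shape T) n \<longleftrightarrow> (\<forall>i j. i \<le> j \<longrightarrow> row_len T j \<le> row_len T i) \<and>
     (\<forall>i<length T. row_len T i > 0) \<and> sum_list (map length T) = n"
proof -
  have "sorted_wrt (\<ge>) (map length T) \<longleftrightarrow> (\<forall>i j. i \<le> j \<longrightarrow> row_len T j \<le> row_len T i)"
    by (auto simp: sorted_wrt_iff_nth_less row_len_def) (metis le_neq_implies_less order_refl)
  moreover have "0 \<notin> set (map length T) \<longleftrightarrow> (\<forall>i<length T. row_len T i > 0)"
    unfolding in_set_conv_nth by (auto simp: row_len_def)
  ultimately show ?thesis by (simp add: is_partition_def shape_def)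
qed

lemma sum_list_add_box:
  "r \<le> length T \<Longrightarrow> sum_list (map length (add_box a T r)) = Suc (sum_list (map length T))"
  by (auto simp: add_box_def map_update sum_list_update member_le_sum_list
      elem_le_sum_list)

lemma SYT_row_len_mono: "T \<in> SYT n \<Longrightarrow> i \<le> j \<Longrightarrow> row_len T j \<le> row_len T i"
  by (auto simp: SYT_def is_partition_row_len)

lemma SYT_row_len_pos: "T \<in> SYT n \<Longrightarrow> i < length T \<Longrightarrow> row_len T i > 0"
  by (auto simp: SYT_def is_partition_row_len)

lemma SYT_entry_in: "T \<in> SYT n \<Longrightarrow> b \<in> boxes T \<Longrightarrow> entry T b \<in> {1..n}"
  by (auto simp: SYT_def bij_betw_def)

lemma SYT_box_exists:
  assumes "T \<in> SYT n" "v \<in> {1..n}"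
  obtains b where "b \<in> boxes T" "entry T b = v"
proof -
  have "entry T ` boxes T = {1..n}" using assms by (simp add: SYT_def bij_betw_def)
  with assms(2) that show ?thesis by (metis imageE)
qed

text \<open>Addability keeps the row lengths weakly decreasing. The new box ends its row and tops
  its column, and its entry exceeds all others, so both order conditions survive.\<close>

lemma add_box_SYT:
  assumes T: "T \<in> SYT n" and r: "r \<in> addable T"
  shows "add_box (Suc n) T r \<in> SYT (Suc n)"
proof -
  let ?T = "add_box (Suc n) T r" and ?b = "(Suc (row_len T r), Suc r)"
  have r': "r \<le> length T" "\<And>i. i < r \<Longrightarrow> row_len T i > row_len T r"
    using r by (auto simp: addable_def)
  note B = boxes_add_box[OF r'(1), of "Suc n"]
  note new = entry_add_box_new[OF r'(1), of "Suc n"]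
  note old = entry_add_box_old[OF r'(1), of _ "Suc n"]
  note mono = SYT_row_len_mono[OF T]
  have "is_partition (shape ?T) (Suc n)"
  proof -
    have "row_len ?T j \<le> row_len ?T i" if "i \<le> j" for i j
      using that mono[OF that] r'(2)[of i] mono[of r j] by (auto simp: row_len_add_box[OF r'(1)])
    moreover have "row_len ?T i > 0" if "i < length ?T" for i
    proof -
      have "i < length T \<or> i = r"
        using that r'(1) by (auto simp: add_box_def split: if_splits)
      then show ?thesis
        using SYT_row_len_pos[OF T, of i] by (auto simp: row_len_add_box[OF r'(1)])
    qed
    moreover have "sum_list (map length ?T) = Suc n"
      using T by (simp add: sum_list_add_box[OF r'(1)] SYT_def is_partition_row_len)
    ultimately show ?thesis by (simp add: is_partition_row_len)
  qed
  moreover have "bij_betw (entry ?T) (boxes ?T) {1..Suc n}"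
  proof -
    have "bij_betw (entry T) (boxes T) {1..n}" using T by (simp add: SYT_def)
    then have "bij_betw (entry ?T) (boxes T) {1..n}"
      by (subst bij_betw_cong[of _ _ "entry T"]) (simp_all add: old)
    then have "bij_betw (entry ?T) (insert ?b (boxes T)) (insert (entry ?T ?b) {1..n})"
      using notIn_Un_bij_betw[of ?b "boxes T" "entry ?T" "{1..n}"] new_box_notin new by simp
    then show ?thesis by (simp add: B new atLeastAtMostSuc_conv)
  qed
  moreover have "entry ?T (c, s) < entry ?T (c + 1, s)"
    if "(c, s) \<in> boxes ?T" "(c + 1, s) \<in> boxes ?T" for c s
  proof (cases "(c + 1, s) \<in> boxes T")
    case True
    with that have "(c, s) \<in> boxes T"
      by (cases "c = 0") (auto simp: boxes_row_len)
    with True T show ?thesis by (auto simp: old SYT_def)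
  next
    case False
    with that have eq: "(c + 1, s) = ?b" by (auto simp: B)
    then have "(c, s) \<in> boxes T" using that by (auto simp: B)
    with eq show ?thesis using SYT_entry_in[OF T] new by (fastforce simp: old less_Suc_eq_le)
  qed
  moreover have "entry ?T (c, s) < entry ?T (c, s + 1)"
    if "(c, s) \<in> boxes ?T" "(c, s + 1) \<in> boxes ?T" for c s
  proof (cases "(c, s + 1) \<in> boxes T")
    case True
    with that mono[of "s - 1" s] have "(c, s) \<in> boxes T"
      by (cases "s = 0") (auto simp: boxes_row_len)
    with True T show ?thesis by (auto simp: old SYT_def)
  next
    case False
    with that have eq: "(c, s + 1) = ?b" by (auto simp: B)
    then have "(c, s) \<in> boxes T" using that by (auto simp: B)
    with eq show ?thesis using SYT_entry_in[OF T] new by (fastforce simp: old less_Suc_eq_le)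
  qed
  ultimately show ?thesis by (simp add: SYT_def)
qed

text \<open>The largest entry has no box to its right or above it, so it sits in a corner and can be
  removed.\<close>

lemma SYT_Suc_obtain:
  assumes T: "T \<in> SYT (Suc n)"
  obtains T0 r where "T0 \<in> SYT n" "r \<in> addable T0" "T = add_box (Suc n) T0 r"
proof -
  obtain b where b: "b \<in> boxes T" "entry T b = Suc n"
    using SYT_box_exists[OF T, of "Suc n"] by auto
  then obtain c r where br: "b = (Suc c, Suc r)"
    by (cases b) (auto simp: boxes_row_len Suc_le_D dest!: Suc_le_D)
  have "(Suc c + 1, Suc r) \<notin> boxes T"
  proof
    assume *: "(Suc c + 1, Suc r) \<in> boxes T"
    then have "entry T b < entry T (Suc c + 1, Suc r)"
      using T b unfolding SYT_def br by blast
    then show False using b SYT_entry_in[OF T *] by auto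
  qed
  then have len: "row_len T r = Suc c"
    using b br by (auto simp: boxes_row_len)
  have "(Suc c, Suc r + 1) \<notin> boxes T"
  proof
    assume *: "(Suc c, Suc r + 1) \<in> boxes T"
    then have "entry T b < entry T (Suc c, Suc r + 1)"
      using T b unfolding SYT_def br by blast
    then show False using b SYT_entry_in[OF T *] by auto
  qed
  then have next_len: "row_len T (Suc r) \<le> c"
    by (auto simp: boxes_row_len)
  note mono = SYT_row_len_mono[OF T]
  have rT: "r < length T" and lenT: "length (T ! r) = Suc c"
    using len by (auto simp: row_len_def split: if_splits)
  have row: "T ! r = butlast (T ! r) @ [Suc n]"
  proof -
    have "T ! r ! c = Suc n" using b br by (simp add: entry_def)
    then have "last (T ! r) = Suc n" using lenT by (simp add: last_conv_nth flip: length_0_conv)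
    then show ?thesis
      using lenT append_butlast_last_id[of "T ! r"] by fastforce
  qed
  \<comment> \<open>For \<open>c = 0\<close> the row consists of the removed box alone and must
    vanish, as a partition has no zero parts; \<open>last_row\<close> shows that it is then the top
    row.\<close>
  define T0 where "T0 = (if c = 0 then butlast T else T[r := butlast (T ! r)])"
  have last_row: "length T = Suc r" if "c = 0"
  proof (rule ccontr)
    assume "length T \<noteq> Suc r"
    with rT have "Suc r < length T" by simp
    with SYT_row_len_pos[OF T, of "Suc r"] next_len that show False by simp
  qed
  have rT0: "r \<le> length T0" using rT last_row by (auto simp: T0_def)
  have eq: "T = add_box (Suc n) T0 r"
  proof (cases "c = 0")
    case True
    then have "butlast (T ! r) = []" using lenT by (simp flip: length_0_conv)
    then have "T ! r = [Suc n]" using row by simp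
    then have "T \<noteq> []" "last T = [Suc n]"
      using last_row[OF True] by (auto simp: last_conv_nth simp flip: length_0_conv)
    then show ?thesis
      using True last_row[OF True] append_butlast_last_id[of T]
      by (simp add: T0_def add_box_def)
  next
    case False
    then show ?thesis using rT row by (simp add: T0_def add_box_def)
  qed
  \<comment> \<open>From here the row lengths, boxes and entries of \<open>T0\<close> are obtained
    by reading the lemmas on \<open>add_box\<close> backwards.\<close>
  have rlT: "row_len T = (row_len T0)(r := Suc (row_len T0 r))"
    using row_len_add_box[OF rT0] eq by metis
  have rl: "row_len T0 i = (if i = r then c else row_len T i)" for i
    using fun_cong[OF rlT, of i] len by (auto split: if_splits)
  have B: "boxes T = insert (Suc c, Suc r) (boxes T0)"
    using boxes_add_box[OF rT0, of "Suc n"] rl[of r] by (simp flip: eq)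
  have old: "entry T b' = entry T0 b'" if "b' \<in> boxes T0" for b'
    using entry_add_box_old[OF rT0 that, of "Suc n"] by (simp flip: eq)
  have notin: "(Suc c, Suc r) \<notin> boxes T0"
    using new_box_notin[of T0 r] rl[of r] by simp
  have "is_partition (shape T0) n"
  proof -
    have "row_len T0 j \<le> row_len T0 i" if "i \<le> j" for i j
      using that mono[OF that] mono[of "Suc r" j] next_len len by (auto simp: rl)
    moreover have "row_len T0 i > 0" if "i < length T0" for i
    proof -
      have "i < length T" "i = r \<Longrightarrow> c > 0"
        using that last_row by (auto simp: T0_def split: if_splits)
      then show ?thesis using SYT_row_len_pos[OF T, of i] by (simp add: rl)
    qed
    moreover have "sum_list (map length T0) = n"
      using T sum_list_add_box[OF rT0, of "Suc n"]
      by (simp add: SYT_def is_partition_row_len flip: eq)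
    ultimately show ?thesis by (simp add: is_partition_row_len)
  qed
  moreover have "bij_betw (entry T0) (boxes T0) {1..n}"
  proof -
    have "bij_betw (entry T) (insert (Suc c, Suc r) (boxes T0)) (insert (Suc n) {1..n})"
      using T by (simp add: SYT_def B atLeastAtMostSuc_conv)
    then have "bij_betw (entry T) (boxes T0) {1..n}"
      using notIn_Un_bij_betw3[of "(Suc c, Suc r)" "boxes T0" "entry T" "{1..n}"] notin b br
      by simp
    then show ?thesis
      by (subst bij_betw_cong[of _ _ "entry T"]) (simp_all add: old)
  qed
  moreover have "entry T0 (d, s) < entry T0 (d + 1, s)"
    if "(d, s) \<in> boxes T0" "(d + 1, s) \<in> boxes T0" for d s
  proof -
    have "(d, s) \<in> boxes T" "(d + 1, s) \<in> boxes T" using that B by auto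
    then show ?thesis using T that by (simp add: SYT_def old flip: old)
  qed
  moreover have "entry T0 (d, s) < entry T0 (d, s + 1)"
    if "(d, s) \<in> boxes T0" "(d, s + 1) \<in> boxes T0" for d s
  proof -
    have "(d, s) \<in> boxes T" "(d, s + 1) \<in> boxes T" using that B by auto
    then show ?thesis using T that by (simp add: SYT_def old flip: old)
  qed
  ultimately have "T0 \<in> SYT n" by (simp add: SYT_def)
  moreover have "r \<in> addable T0"
  proof -
    have "row_len T0 i > row_len T0 r" if "i < r" for i
      using that mono[of i r] len by (simp add: rl)
    with rT0 show ?thesis by (simp add: addable_def)
  qed
  ultimately show ?thesis using eq that by blast
qed

text \<open>The entry \<open>Suc n\<close> occupies a single box of the common tableau, which
  determines the row and its former length; removing it recovers the smaller tableau.\<close>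

lemma add_box_inj:
  assumes S: "S \<in> SYT n" and T: "T \<in> SYT n" and r: "r \<in> addable S" and s: "s \<in> addable T"
    and eq: "add_box (Suc n) S r = add_box (Suc n) T s"
  shows "S = T \<and> r = s"
proof -
  have rs: "r \<le> length S" "s \<le> length T" using r s by (auto simp: addable_def)
  let ?U = "add_box (Suc n) T s"
  have U: "?U \<in> SYT (Suc n)" by (rule add_box_SYT[OF T s])
  have "(Suc (row_len S r), Suc r) \<in> boxes ?U" "(Suc (row_len T s), Suc s) \<in> boxes ?U"
    using boxes_add_box[OF rs(1), of "Suc n"] boxes_add_box[OF rs(2), of "Suc n"] eq
    by (metis insertI1)+
  moreover have "entry ?U (Suc (row_len S r), Suc r) = entry ?U (Suc (row_len T s), Suc s)"
    using entry_add_box_new[OF rs(1), of "Suc n"] entry_add_box_new[OF rs(2), of "Suc n"] eq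
    by simp
  ultimately have "(Suc (row_len S r), Suc r) = (Suc (row_len T s), Suc s)"
    using box_of_eq[OF U] by metis
  then have rs_eq: "r = s" and l: "row_len S r = row_len T s" by auto
  \<comment> \<open>The former length of the row tells whether the box extended a row or started a
    new one.\<close>
  have ends: "r < length S \<longleftrightarrow> row_len S r > 0" "s < length T \<longleftrightarrow> row_len T s > 0"
    using SYT_row_len_pos[OF S, of r] SYT_row_len_pos[OF T, of s] by (auto simp: row_len_def)
  have "S = T"
  proof (cases "r < length S")
    case True
    then have sT: "s < length T" using ends l by simp
    have e: "S[r := S ! r @ [Suc n]] = T[r := T ! r @ [Suc n]]"
      using eq True sT rs_eq by (simp add: add_box_def)
    then have "S[r := S ! r @ [Suc n]] ! r = T[r := T ! r @ [Suc n]] ! r" by simp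
    then have "S ! r = T ! r" using True sT rs_eq by simp
    then show ?thesis using e by (metis list_update_id list_update_overwrite)
  next
    case False
    then have "\<not> s < length T" using ends l by simp
    then show ?thesis using eq False by (simp add: add_box_def)
  qed
  with rs_eq show ?thesis by simp
qed

lemma bij_betw_add_box:
  "bij_betw (\<lambda>(T, r). add_box (Suc n) T r) (Sigma (SYT n) addable) (SYT (Suc n))"
  unfolding bij_betw_def
proof
  show "inj_on (\<lambda>(T, r). add_box (Suc n) T r) (Sigma (SYT n) addable)"
    by (rule inj_onI) (auto dest: add_box_inj)
  show "(\<lambda>(T, r). add_box (Suc n) T r) ` Sigma (SYT n) addable = SYT (Suc n)"
    by (auto intro: add_box_SYT elim: SYT_Suc_obtain)
qed

section \<open>The g-index\<close>

lemma g_val_entry: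
  assumes "T \<in> SYT n" "(i, j) \<in> boxes T"
  shows "g_val m T (entry T (i, j)) =
    card {j'. j' \<ge> j \<and> (i - 1, j') \<in> ext_boxes m T \<and> entry T (i - 1, j') \<le> entry T (i, j)}"
  unfolding g_val_def box_of_eq[OF assms] by simp

text \<open>The two extra boxes, the added one and the new top box of column 0, both carry
  \<open>Suc n\<close>, which is larger than \<open>v\<close> and hence not counted.\<close>

lemma g_val_add_box_old:
  assumes T: "T \<in> SYT n" and r: "r \<in> addable T" and v: "v \<in> {1..n}"
  shows "g_val (Suc n) (add_box (Suc n) T r) v = g_val n T v"
proof -
  let ?T = "add_box (Suc n) T r"
  have rl: "r \<le> length T" using r by (simp add: addable_def)
  note B = boxes_add_box[OF rl, of "Suc n"]
  obtain i j where ij: "(i, j) \<in> boxes T" "entry T (i, j) = v"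
    using SYT_box_exists[OF T v] by (metis surj_pair)
  then have ij': "(i, j) \<in> boxes ?T" "entry ?T (i, j) = v"
    using B entry_add_box_old[OF rl ij(1)] by auto
  have "b \<in> ext_boxes (Suc n) ?T \<and> entry ?T b \<le> v \<longleftrightarrow> b \<in> ext_boxes n T \<and> entry T b \<le> v" for b
  proof (cases "fst b = 0")
    case True
    then show ?thesis using v
      by (cases b) (auto simp: ext_boxes_def entry_def boxes_row_len)
  next
    case False
    then show ?thesis
      using v entry_add_box_old[OF rl, of b "Suc n"] entry_add_box_new[OF rl, of "Suc n"]
      by (cases b) (auto simp: ext_boxes_def B new_box_notin)
  qed
  then show ?thesis
    using g_val_entry[OF add_box_SYT[OF T r] ij'(1), of "Suc n"] g_val_entry[OF T ij(1), of n]
    by (simp add: ij ij')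
qed

text \<open>No entry exceeds \<open>Suc n\<close>, so only positions matter. A new top row sees the
  labels r + 1, ..., n + 1 of column 0; otherwise the rows from \<open>r\<close> upwards that reach
  column \<open>row_len T r\<close> are counted.\<close>

lemma g_val_add_box_new:
  assumes T: "T \<in> SYT n" and r: "r \<in> addable T"
  shows "g_val (Suc n) (add_box (Suc n) T r) (Suc n) =
    (if r = length T then n + 1 - r
     else card {j \<in> {..<length T}. r \<le> j \<and> row_len T j = row_len T r})"
proof -
  let ?T = "add_box (Suc n) T r" and ?c = "row_len T r"
  have rl: "r \<le> length T" using r by (simp add: addable_def)
  note U = add_box_SYT[OF T r]
  have b: "(Suc ?c, Suc r) \<in> boxes ?T" "entry ?T (Suc ?c, Suc r) = Suc n"
    using boxes_add_box[OF rl] entry_add_box_new[OF rl] by auto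
  have g: "g_val (Suc n) ?T (Suc n) =
      card {j'. j' \<ge> Suc r \<and> (?c, j') \<in> ext_boxes (Suc n) ?T \<and> entry ?T (?c, j') \<le> Suc n}"
    using g_val_entry[OF U b(1), of "Suc n"] b(2) by simp
  show ?thesis
  proof (cases "r = length T")
    case True
    then have "?c = 0" by (simp add: row_len_def)
    then have "{j'. j' \<ge> Suc r \<and> (?c, j') \<in> ext_boxes (Suc n) ?T \<and> entry ?T (?c, j') \<le> Suc n} =
        {Suc r..Suc n}"
      by (auto simp: ext_boxes_def entry_def boxes_row_len)
    with True g show ?thesis by simp
  next
    case False
    with rl have "r < length T" by simp
    with SYT_row_len_pos[OF T] have c: "?c > 0" by simp
    have "{j'. j' \<ge> Suc r \<and> (?c, j') \<in> ext_boxes (Suc n) ?T \<and> entry ?T (?c, j') \<le> Suc n} =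
        {j'. j' \<ge> Suc r \<and> (?c, j') \<in> boxes ?T}"
      using c SYT_entry_in[OF U] by (auto simp: ext_boxes_def)
    also have "\<dots> = Suc ` {j \<in> {..<length T}. r \<le> j \<and> row_len T j = row_len T r}"
    proof (intro set_eqI iffI)
      fix k assume k: "k \<in> {j'. j' \<ge> Suc r \<and> (?c, j') \<in> boxes ?T}"
      then obtain j where j: "k = Suc j" "r \<le> j" by (auto dest: Suc_le_D)
      with k have "row_len T r \<le> row_len T j"
        by (auto simp: boxes_row_len row_len_add_box[OF rl] split: if_splits)
      \<comment> \<open>A row above \<open>r\<close> is no longer than row \<open>r\<close>, so
        reaching its last column forces equal length.\<close>
      with SYT_row_len_mono[OF T j(2)] have "row_len T j = row_len T r" by simp
      moreover from this c have "j < length T" by (auto simp: row_len_def split: if_splits)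
      ultimately show "k \<in> Suc ` {j \<in> {..<length T}. r \<le> j \<and> row_len T j = row_len T r}"
        using j by auto
    next
      fix k assume "k \<in> Suc ` {j \<in> {..<length T}. r \<le> j \<and> row_len T j = row_len T r}"
      then show "k \<in> {j'. j' \<ge> Suc r \<and> (?c, j') \<in> boxes ?T}"
        using c by (auto simp: boxes_row_len row_len_add_box[OF rl])
    qed
    finally show ?thesis using False g by (simp add: card_image)
  qed
qed

lemma g_index_add_box:
  assumes "T \<in> SYT n" "r \<in> addable T"
  shows "g_index (Suc n) (add_box (Suc n) T r) =
    g_index n T * g_val (Suc n) (add_box (Suc n) T r) (Suc n)"
proof -
  have "(\<Prod>v = 1..n. g_val (Suc n) (add_box (Suc n) T r) v) = (\<Prod>v = 1..n. g_val n T v)"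
    by (rule prod.cong) (simp_all only: g_val_add_box_old[OF assms])
  then show ?thesis by (simp add: g_index_def)
qed

section \<open>Summation over the addable rows\<close>

text \<open>The addable rows inside the tableau are the lowest rows of the blocks of equal length,
  and these blocks partition all rows.\<close>

lemma sum_card_equal_rows:
  assumes mono: "\<And>i j. i \<le> j \<Longrightarrow> row_len T j \<le> row_len T i"
  shows "(\<Sum>r\<in>addable T - {length T}.
    card {j \<in> {..<length T}. r \<le> j \<and> row_len T j = row_len T r}) = length T"
proof -
  let ?C = "\<lambda>r. {j \<in> {..<length T}. r \<le> j \<and> row_len T j = row_len T r}"
  let ?A = "addable T - {length T}"
  have fin: "finite ?A" by (simp add: finite_addable)
  have disj: "\<forall>r\<in>?A. \<forall>s\<in>?A. r \<noteq> s \<longrightarrow> ?C r \<inter> ?C s = {}"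
  proof (intro ballI impI)
    fix r s assume "r \<in> ?A" "s \<in> ?A" "r \<noteq> s"
    \<comment> \<open>Of two addable rows, the higher one is strictly shorter.\<close>
    then have "row_len T r \<noteq> row_len T s"
      by (metis (mono_tags, lifting) DiffD1 addable_def less_irrefl linorder_neqE_nat
          mem_Collect_eq)
    then show "?C r \<inter> ?C s = {}" by auto
  qed
  have "(\<Union>r\<in>?A. ?C r) = {..<length T}"
  proof (intro equalityI subsetI)
    fix j assume j: "j \<in> {..<length T}"
    \<comment> \<open>The lowest row of the block containing \<open>j\<close>; by minimality and
      monotonicity all rows below it are strictly longer.\<close>
    define r where "r = (LEAST i. row_len T i = row_len T j)"
    have r: "row_len T r = row_len T j" "r \<le> j"
      unfolding r_def by (rule LeastI, rule refl) (rule Least_le, rule refl)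
    have "row_len T i > row_len T r" if "i < r" for i
      using mono[of i r] that not_less_Least[of i "\<lambda>i. row_len T i = row_len T j"] r(1)
      by (auto simp: le_less r_def)
    then have "r \<in> ?A" using r j by (auto simp: addable_def)
    moreover have "j \<in> ?C r" using r j by auto
    ultimately show "j \<in> (\<Union>r\<in>?A. ?C r)" by blast
  qed auto
  then show ?thesis
    using card_UN_disjoint[OF fin _ disj] by simp
qed

lemma sum_add_box:
  assumes T: "T \<in> SYT n"
  shows "(\<Sum>r\<in>addable T. monom (int (g_index (Suc n) (add_box (Suc n) T r)))
      (Suc n + 1 - length (shape (add_box (Suc n) T r)))) =
    eulerian_step n (monom (int (g_index n T)) (n + 1 - length (shape T)))"
proof -
  let ?l = "length T" and ?G = "int (g_index n T)"
  let ?C = "\<lambda>r. {j \<in> {..<?l}. r \<le> j \<and> row_len T j = row_len T r}"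
  let ?f = "\<lambda>r. monom (int (g_index (Suc n) (add_box (Suc n) T r)))
      (Suc n + 1 - length (shape (add_box (Suc n) T r)))"
  have top: "?l \<in> addable T"
    using SYT_row_len_pos[OF T] by (auto simp: addable_def row_len_def)
  \<comment> \<open>Every row is nonempty. The bound ensures that the truncated difference n + 1 -
    \<open>?l\<close> behaves like the integer one in the exponents and coefficients.\<close>
  have ln: "?l \<le> n"
  proof -
    have "(\<Sum>i<?l. 1) \<le> (\<Sum>i<?l. row_len T i)"
      using SYT_row_len_pos[OF T] by (intro sum_mono) (simp add: Suc_le_eq)
    also have "\<dots> = sum_list (map length T)"
      by (simp add: sum_list_sum_nth atLeast0LessThan row_len_def)
    also have "\<dots> = n" using T by (simp add: SYT_def is_partition_row_len)
    finally show ?thesis by simp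
  qed
  have "(\<Sum>r\<in>addable T. ?f r) = ?f ?l + (\<Sum>r\<in>addable T - {?l}. ?f r)"
    by (rule sum.remove[OF finite_addable top])
  \<comment> \<open>A new row raises the size and the number of rows together, so the exponent does
    not change.\<close>
  also have "?f ?l = monom (?G * int (n + 1 - ?l)) (n + 1 - ?l)"
    by (simp add: g_index_add_box[OF T top] g_val_add_box_new[OF T top])
       (simp add: shape_def add_box_def)
  also have "(\<Sum>r\<in>addable T - {?l}. ?f r) =
      (\<Sum>r\<in>addable T - {?l}. monom (?G * int (card (?C r))) (Suc (n + 1 - ?l)))"
  proof (rule sum.cong[OF refl])
    fix r assume r: "r \<in> addable T - {?l}"
    then have "length (shape (add_box (Suc n) T r)) = ?l"
      by (auto simp: addable_def add_box_def shape_def)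
    moreover have "Suc n + 1 - ?l = Suc (n + 1 - ?l)" using ln by simp
    ultimately show "?f r = monom (?G * int (card (?C r))) (Suc (n + 1 - ?l))"
      using r g_index_add_box[OF T, of r] g_val_add_box_new[OF T, of r] by simp
  qed
  also have "\<dots> = monom (?G * int (\<Sum>r\<in>addable T - {?l}. card (?C r))) (Suc (n + 1 - ?l))"
    by (simp add: sum_distrib_left monom_sum)
  also have "(\<Sum>r\<in>addable T - {?l}. card (?C r)) = ?l"
    by (rule sum_card_equal_rows[OF SYT_row_len_mono[OF T]])
  \<comment> \<open>With d = n + 1 - \<open>?l\<close>, the coefficient becomes the n + 1 - d of
    \<open>eulerian_step_monom\<close>.\<close>
  also have "int ?l = int n + 1 - int (n + 1 - ?l)" using ln by simp
  finally show ?thesis by (simp add: eulerian_step_monom shape_def)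
qed

section \<open>Comparison of the two polynomials\<close>

definition tableau_poly :: "nat \<Rightarrow> int poly" where
  "tableau_poly n = (\<Sum>T\<in>SYT n. monom (int (g_index n T)) (n + 1 - length (shape T)))"

lemma tableau_poly_Suc: "tableau_poly (Suc n) = eulerian_step n (tableau_poly n)"
proof -
  have "tableau_poly (Suc n) = (\<Sum>(T, r)\<in>Sigma (SYT n) addable.
      monom (int (g_index (Suc n) (add_box (Suc n) T r)))
        (Suc n + 1 - length (shape (add_box (Suc n) T r))))"
    unfolding tableau_poly_def sum.reindex_bij_betw[OF bij_betw_add_box, symmetric]
    by (simp add: case_prod_unfold)
  also have "\<dots> = (\<Sum>T\<in>SYT n. \<Sum>r\<in>addable T.
      monom (int (g_index (Suc n) (add_box (Suc n) T r)))
        (Suc n + 1 - length (shape (add_box (Suc n) T r))))"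
    by (rule sum.Sigma[symmetric]) (auto simp: finite_SYT finite_addable)
  also have "\<dots> = (\<Sum>T\<in>SYT n. eulerian_step n
      (monom (int (g_index n T)) (n + 1 - length (shape T))))"
    by (rule sum.cong[OF refl]) (rule sum_add_box)
  finally show ?thesis by (simp add: tableau_poly_def eulerian_step_sum)
qed

lemma SYT_0: "SYT 0 = {[]}"
proof -
  have "T = []" if "T \<in> SYT 0" for T
  proof (rule ccontr)
    assume "T \<noteq> []"
    with SYT_row_len_pos[OF that, of 0] have "(1, 1) \<in> boxes T"
      by (simp add: boxes_row_len Suc_le_eq)
    with SYT_entry_in[OF that] show False by fastforce
  qed
  moreover have "boxes [] = {}" by (auto simp: boxes_row_len row_len_def)
  then have "[] \<in> SYT 0" by (simp add: SYT_def is_partition_def shape_def bij_betw_def)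
  ultimately show ?thesis by blast
qed

text \<open>In size 0 the two sides are \<open>1\<close> and \<open>x\<close>, but the recurrence sends both to \<open>x\<close>.\<close>

lemma Eulerian_poly_eq_tableau_poly: "Eulerian_poly (Suc n) = tableau_poly (Suc n)"
proof (induction n)
  case 0
  have "Eulerian_poly 0 = monom 1 0"
    by (simp add: Eulerian_poly_def des_def)
  moreover have "tableau_poly 0 = monom 1 1"
    by (simp add: tableau_poly_def SYT_0 g_index_def shape_def)
  ultimately show ?case
    unfolding Eulerian_poly_Suc tableau_poly_Suc by (simp only: eulerian_step_monom) simp
next
  case (Suc n)
  then show ?case by (simp only: Eulerian_poly_Suc[of "Suc n"] tableau_poly_Suc[of "Suc n"])
qed

theorem theorem17:
  fixes n :: nat
  assumes "n \<ge> 1"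
  shows "Eulerian_poly n =
    (\<Sum>T\<in>SYT n. monom (int (g_index n T)) (n + 1 - length (shape T)))"
  using Eulerian_poly_eq_tableau_poly[of "n - 1"] assms by (simp add: tableau_poly_def)

end
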